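(* Let $m\in\mathbb{N}$, let $\alpha_j,\beta_j,\gamma,b,c\in\mathbb{C}$ $(j=1,\dots,m)$ and let $\kappa>0$ be real, with $\sum_{j=1}^m\Re(\alpha_j)>\max\{0,\kappa-1\}$, $\Re(\beta_j)>0$ for all $j$, and $\Re(\gamma)>0$. Let $\lambda,\delta\in\mathbb{C}$ with $\Re(\delta)>\Re(\lambda)>0$. Then for every $x>0$, $$\left(I_{-}^{\lambda}\left\{t^{-\delta}\mathcal{J}_{(\beta_j)_m,\kappa,b}^{(\alpha_j)_m,\gamma,c}\left(\frac1t\right)\right\}\right)(x)=\frac{x^{\lambda-\delta}}{\Gamma(\gamma)}\;{}_2\Psi_{m+1}\left[\begin{array}{c}(\gamma,\kappa),(\delta-\lambda,1)\\ \left(\beta_j+\frac{b+1}{2},\alpha_j\right)_{j=1}^m,(\delta,1)\end{array}\Big|\;\frac{c}{x}\right].$$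
   Context: The generalized multiindex Bessel function is $$\mathcal{J}_{(\beta_j)_m,\kappa,b}^{(\alpha_j)_m,\gamma,c}[z]=\sum_{n=0}^\infty\frac{c^n(\gamma)_{\kappa n}}{\prod_{j=1}^m\Gamma\left(\alpha_jn+\beta_j+\frac{b+1}{2}\right)}\frac{z^n}{n!},\qquad (\gamma)_{\nu}=\frac{\Gamma(\gamma+\nu)}{\Gamma(\gamma)}.$$ The Fox–Wright function is given by the series $${}_p\Psi_q\left[\begin{array}{c}(a_1,A_1),\dots,(a_p,A_p)\\(b_1,B_1),\dots,(b_q,B_q)\end{array}\Big|\;z\right]=\sum_{n=0}^\infty\frac{\Gamma(a_1+A_1n)\cdots\Gamma(a_p+A_pn)}{\Gamma(b_1+B_1n)\cdots\Gamma(b_q+B_qn)}\frac{z^n}{n!},$$ where some of the $B_j$ may be complex (here $B_j=\alpha_j$). Throughout, $1/\Gamma$ is the entire reciprocal Gamma function, with value $0$ at the poles of $\Gamma$. The notation $\left(\beta_j+\frac{b+1}{2},\alpha_j\right)_{j=1}^m$ stands for the list of the $m$ pairs $\left(\beta_j+\frac{b+1}{2},\alpha_j\right)$. The right-sided Riemann–Liouville fractional integral is, for $\Re(\lambda)>0$ and $x>0$, $$(I_{-}^\lambda f)(x)=\frac{1}{\Gamma(\lambda)}\int_x^\infty\frac{f(t)}{(t-x)^{1-\lambda}}\,dt.$$ *)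

theory Defs
  imports "HOL-Analysis.Analysis"
begin

text \<open>
  The generalized Pochhammer symbol with an arbitrary complex shift \<open>\<nu>\<close>;
  the library's \<open>pochhammer\<close> only covers natural-number shifts.
\<close>
definition gpochhammer :: "complex \<Rightarrow> complex \<Rightarrow> complex" where
  "gpochhammer \<gamma> \<nu> = Gamma (\<gamma> + \<nu>) / Gamma \<gamma>"

text \<open>
  In both series the reciprocal Gamma factors are written with \<open>rGamma\<close>, the entire
  function \<open>1/\<Gamma>\<close>. The parameter families \<open>\<alpha>\<close>, \<open>\<beta>\<close> are only inspected at the
  indices \<open>1, \<dots>, m\<close>.
\<close>
definition multiindex_bessel_term ::
  "nat \<Rightarrow> (nat \<Rightarrow> complex) \<Rightarrow> (nat \<Rightarrow> complex) \<Rightarrow> complex \<Rightarrow> real \<Rightarrow> complex \<Rightarrow> complex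
     \<Rightarrow> complex \<Rightarrow> nat \<Rightarrow> complex" where
  "multiindex_bessel_term m \<alpha> \<beta> \<gamma> \<kappa> b c z n =
     c ^ n * gpochhammer \<gamma> (of_real \<kappa> * of_nat n)
       * (\<Prod>j=1..m. rGamma (\<alpha> j * of_nat n + \<beta> j + (b + 1) / 2)) * (z ^ n / fact n)"

definition multiindex_bessel ::
  "nat \<Rightarrow> (nat \<Rightarrow> complex) \<Rightarrow> (nat \<Rightarrow> complex) \<Rightarrow> complex \<Rightarrow> real \<Rightarrow> complex \<Rightarrow> complex
     \<Rightarrow> complex \<Rightarrow> complex" where
  "multiindex_bessel m \<alpha> \<beta> \<gamma> \<kappa> b c z = (\<Sum>n. multiindex_bessel_term m \<alpha> \<beta> \<gamma> \<kappa> b c z n)"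

text \<open>
  The parameter lists consist of the upper pairs \<open>(a\<^sub>i, A\<^sub>i)\<close> and the lower pairs
  \<open>(b\<^sub>j, B\<^sub>j)\<close>; \<open>p\<close> and \<open>q\<close> are their lengths.
\<close>
definition fox_wright_term ::
  "(complex \<times> complex) list \<Rightarrow> (complex \<times> complex) list \<Rightarrow> complex \<Rightarrow> nat \<Rightarrow> complex" where
  "fox_wright_term as bs z n =
     (\<Prod>(a, A)\<leftarrow>as. Gamma (a + A * of_nat n)) * (\<Prod>(b, B)\<leftarrow>bs. rGamma (b + B * of_nat n))
       * (z ^ n / fact n)"

definition fox_wright ::
  "(complex \<times> complex) list \<Rightarrow> (complex \<times> complex) list \<Rightarrow> complex \<Rightarrow> complex" where
  "fox_wright as bs z = (\<Sum>n. fox_wright_term as bs z n)"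

definition rl_right_integrand ::
  "complex \<Rightarrow> (real \<Rightarrow> complex) \<Rightarrow> real \<Rightarrow> real \<Rightarrow> complex" where
  "rl_right_integrand l f x t = f t / complex_of_real (t - x) powr (1 - l)"

definition rl_right_integral :: "complex \<Rightarrow> (real \<Rightarrow> complex) \<Rightarrow> real \<Rightarrow> complex" where
  "rl_right_integral l f x =
     1 / Gamma l * (LINT t:{x<..}|lborel. rl_right_integrand l f x t)"

end

theory Submission
  imports Defs
begin

text \<open>
  Writing \<open>\<Gamma>(a) t\<^sup>-\<^sup>a\<close> as a Laplace integral and exchanging the order of integration gives
  \<open>\<integral>\<^sub>x\<^sup>\<infinity> t\<^sup>-\<^sup>a (t - x)\<^sup>\<lambda>\<^sup>-\<^sup>1 dt = \<Gamma>(\<lambda>) \<Gamma>(a - \<lambda>) / \<Gamma>(a) \<cdot> x\<^sup>\<lambda>\<^sup>-\<^sup>a\<close>; applied with \<open>a = \<delta> + n\<close> to each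
  term of the Bessel series it produces the Fox--Wright series.  Summation and integration commute
  because the Bessel coefficients are absolutely summable against every \<open>z\<^sup>n\<close>: up to factors
  \<open>exp (O(n))\<close> the \<open>n\<close>-th one is at most \<open>n\<close> to the power \<open>(\<kappa> - 1 - \<Sum>\<^sub>j Re \<alpha>\<^sub>j) n\<close>.
  For this, \<open>1/\<Gamma>\<close> is bounded along \<open>\<alpha> n + \<beta>\<close> for arbitrary complex \<open>\<alpha>\<close> (possibly with
  \<open>Re \<alpha> \<le> 0\<close>) by shifting the argument to the right by a multiple of \<open>n\<close>.
\<close>

section \<open>Half-line integrals: the Laplace transform of a power and the beta integral\<close>

lemma borel_measurable_indicator_complex_powr [measurable]:
  "(\<lambda>t. indicator {0<..} t *\<^sub>R (complex_of_real t powr z)) \<in> borel_measurable borel"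
proof -
  have "(\<lambda>t. indicator {0<..} t *\<^sub>R (complex_of_real t powr z)) =
        (\<lambda>t. indicator {0<..} t *\<^sub>R exp (z * complex_of_real (ln t)))"
    by (auto simp: fun_eq_iff indicator_def powr_def Ln_of_real)
  thus ?thesis by simp
qed

lemma integrable_mult_leftD:
  fixes f :: "'a \<Rightarrow> complex"
  assumes "integrable M (\<lambda>x. c * f x)" "c \<noteq> 0"
  shows "integrable M f"
  using integrable_mult_right[of "inverse c" M "\<lambda>x. c * f x"] assms
  by (simp add: mult.assoc[symmetric])

text \<open>Euler's integral for \<open>Gamma z\<close> is the case \<open>a = 1\<close>; the
  substitution of \<open>a * t\<close> for \<open>t\<close> produces the factor
  \<open>a powr (-z)\<close>.\<close>

lemma laplace_powr:
  fixes z :: complex and a :: real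
  assumes "Re z > 0" "a > 0"
  defines "g \<equiv> \<lambda>t. indicator {0<..} t *\<^sub>R (complex_of_real t powr (z - 1)) * of_real (exp (-(a * t)))"
  shows "integrable lborel g" "integral\<^sup>L lborel g = Gamma z * of_real a powr (-z)"
proof -
  define f where "f = (\<lambda>t. indicator {0<..} t *\<^sub>R (complex_of_real t powr (z - 1)) * of_real (exp (-t)))"
  have f_eq: "f = (\<lambda>t. indicator {0<..} t *\<^sub>R (complex_of_real t powr (z - 1) / of_real (exp t)))"
    by (auto simp: f_def fun_eq_iff exp_minus field_simps)
  have meas: "f \<in> borel_measurable borel"
    unfolding f_def by measurable
  have ai: "set_integrable lebesgue {0<..} (\<lambda>t. complex_of_real t powr (z - 1) / of_real (exp t))"
    using absolutely_integrable_Gamma_integral'[OF assms(1)] .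
  \<comment> \<open>Euler's integral is stated for the completed measure; Borel measurability of
    \<open>f\<close> transfers it to \<open>lborel\<close>, where Fubini is applied later.\<close>
  hence int: "integrable lborel f"
    using meas unfolding set_integrable_def f_eq[symmetric]
    by (subst (asm) integrable_completion) auto
  have val: "integral\<^sup>L lborel f = Gamma z"
  proof -
    have "integral\<^sup>L lborel f = integral\<^sup>L lebesgue f"
      using meas by (subst integral_completion) auto
    also have "\<dots> = integral {0<..} (\<lambda>t. complex_of_real t powr (z - 1) / of_real (exp t))"
      using set_lebesgue_integral_eq_integral(2)[OF ai]
      unfolding set_lebesgue_integral_def f_eq .
    also have "\<dots> = Gamma z"
      using Gamma_integral_complex'[OF assms(1)] by (rule integral_unique)
    finally show ?thesis .
  qed
  have g_eq: "f (0 + a * t) = of_real a powr (z - 1) * g t" for t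
    using assms(2)
    by (cases "t > 0")
       (auto simp: f_def g_def indicator_def powr_times_real zero_less_mult_iff algebra_simps)
  have nz: "complex_of_real a powr (z - 1) \<noteq> 0" using assms(2) by simp
  have "integrable lborel (\<lambda>t. f (0 + a * t))"
    using assms(2) int by (intro lborel_integrable_real_affine) auto
  thus "integrable lborel g" unfolding g_eq using nz by (rule integrable_mult_leftD)
  have "Gamma z = \<bar>a\<bar> *\<^sub>R (\<integral>t. f (0 + a * t) \<partial>lborel)"
    unfolding val[symmetric] using assms(2) by (intro lborel_integral_real_affine) auto
  also have "\<dots> = of_real a * (of_real a powr (z - 1) * integral\<^sup>L lborel g)"
    unfolding g_eq using assms(2) by (simp add: scaleR_conv_of_real)
  also have "\<dots> = of_real a powr z * integral\<^sup>L lborel g"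
    using assms(2) by (simp add: powr_diff)
  finally have "Gamma z = of_real a powr z * integral\<^sup>L lborel g" .
  thus "integral\<^sup>L lborel g = Gamma z * of_real a powr (-z)"
    using assms(2) by (simp add: powr_minus field_simps)
qed

text \<open>Here \<open>u\<close> stands for \<open>t - x\<close>. The double integrand
  \<open>f\<close> of the proof gives \<open>Gamma a * h u\<close> when integrated over
  \<open>s\<close>, and a Laplace integrand with parameter \<open>a - l\<close> when integrated over
  \<open>u\<close>; equating the iterated integrals yields the value.\<close>

lemma beta_integral_half_line:
  fixes a l :: complex and x :: real
  assumes x: "x > 0" and l: "Re l > 0" and a: "Re a > Re l"
  defines "h \<equiv> \<lambda>u. complex_of_real (x + u) powr (-a) * (indicator {0<..} u *\<^sub>R (of_real u powr (l - 1)))"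
  shows "integrable lborel h"
    and "integral\<^sup>L lborel h = Gamma l * Gamma (a - l) / Gamma a * of_real x powr (l - a)"
proof -
  define P where "P = (\<lambda>z t. indicator {0<..} t *\<^sub>R (complex_of_real t powr z))"
  define f where "f = (\<lambda>(s, u). P (a - 1) s * P (l - 1) u * of_real (exp (-((x + u) * s))))"
  have P_meas[measurable]: "P z \<in> borel_measurable borel" for z
    unfolding P_def by measurable
  have f_meas[measurable]: "f \<in> borel_measurable (lborel \<Otimes>\<^sub>M lborel)"
    unfolding f_def by measurable
  have normP: "complex_of_real (norm (P z t)) = P (of_real (Re z)) t" for z t
    by (auto simp: P_def indicator_def norm_powr_real_powr powr_of_real)
  have P_mult: "P z t * P w t = P (z + w) t" for z w t
    by (auto simp: P_def indicator_def powr_add)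
  have P0: "P z t = 0" if "t \<le> 0" for z t
    using that by (simp add: P_def)
  have lap: "integrable lborel (\<lambda>t. P (z - 1) t * of_real (exp (-(c * t))))"
      "(\<integral>t. P (z - 1) t * of_real (exp (-(c * t))) \<partial>lborel) = Gamma z * of_real c powr (-z)"
    if "Re z > 0" "c > 0" for z c
    using laplace_powr[OF that] by (simp_all add: P_def)
  have f_eq_u: "f (s, u) = P (a - 1) s * of_real (exp (-(x * s))) * (P (l - 1) u * of_real (exp (-(s * u))))"
    for s u by (simp add: f_def algebra_simps exp_diff exp_minus divide_inverse)
  have f_eq_s: "f (s, u) = P (l - 1) u * (P (a - 1) s * of_real (exp (-((x + u) * s))))" for s u
    by (simp add: f_def)
  have int_u: "integrable lborel (\<lambda>u. f (s, u))" for s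
  proof (cases "s > 0")
    case True
    show ?thesis unfolding f_eq_u using lap(1)[OF l True] by simp
  qed (simp add: f_def P0)
  have val_u: "(\<integral>u. f (s, u) \<partial>lborel) = Gamma l * (P ((a - l) - 1) s * of_real (exp (-(x * s))))" for s
  proof (cases "s > 0")
    case True
    have "(\<integral>u. f (s, u) \<partial>lborel) = P (a - 1) s * of_real (exp (-(x * s))) * (Gamma l * P (-l) s)"
      unfolding f_eq_u integral_mult_right_zero lap(2)[OF l True] using True by (simp add: P_def)
    also have "\<dots> = Gamma l * ((P (a - 1) s * P (-l) s) * of_real (exp (-(x * s))))" by simp
    finally show ?thesis unfolding P_mult by (simp add: algebra_simps)
  qed (simp add: f_def P0)
  \<comment> \<open>Taking norms replaces the exponents by their real parts, so the inner integral
    is again a Laplace integral. The outcome is a constant times the norm of the function in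
    \<open>int_s\<close>, which is the integrability that Fubini asks for.\<close>
  have norm_u: "(\<integral>u. norm (f (s, u)) \<partial>lborel) =
      Gamma (Re l) * norm (P ((a - l) - 1) s * of_real (exp (-(x * s))))" for s
  proof (cases "s > 0")
    case True
    have "complex_of_real (\<integral>u. norm (f (s, u)) \<partial>lborel) = (\<integral>u. complex_of_real (norm (f (s, u))) \<partial>lborel)"
      by simp
    also have "\<dots> = (\<integral>u. P (of_real (Re (a - 1))) s * of_real (exp (-(x * s)))
        * (P (of_real (Re l) - 1) u * of_real (exp (-(s * u)))) \<partial>lborel)"
      using normP[of "a - 1"] normP[of "l - 1"] by (simp add: f_eq_u norm_mult)
    also have "\<dots> = P (of_real (Re (a - 1))) s * of_real (exp (-(x * s))) * (Gamma (of_real (Re l)) * P (- of_real (Re l)) s)"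
      unfolding integral_mult_right_zero
      by (subst lap(2)) (use l True in \<open>auto simp: P_def\<close>)
    also have "\<dots> = Gamma (of_real (Re l)) * ((P (of_real (Re (a - 1))) s * P (- of_real (Re l)) s) * of_real (exp (-(x * s))))"
      by simp
    also have "P (of_real (Re (a - 1))) s * P (- of_real (Re l)) s = of_real (norm (P ((a - l) - 1) s))"
      unfolding P_mult normP by (simp add: algebra_simps)
    also have "Gamma (of_real (Re l)) * (complex_of_real (norm (P ((a - l) - 1) s)) * of_real (exp (-(x * s))))
       = complex_of_real (Gamma (Re l) * norm (P ((a - l) - 1) s * of_real (exp (-(x * s)))))"
      by (simp add: norm_mult Gamma_complex_of_real)
    finally show ?thesis unfolding of_real_eq_iff .
  qed (simp add: f_def P0)
  have int_s: "integrable lborel (\<lambda>s. P ((a - l) - 1) s * of_real (exp (-(x * s))))"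
    using lap(1)[of "a - l" x] a x by simp
  have int_f: "integrable (lborel \<Otimes>\<^sub>M lborel) f"
  proof (rule lborel_pair.Fubini_integrable)
    show "integrable lborel (\<lambda>s. \<integral>u. norm (f (s, u)) \<partial>lborel)"
      unfolding norm_u using integrable_norm[OF int_s] by simp
  qed (use int_u f_meas in simp_all)
  have val_s: "(\<integral>s. f (s, u) \<partial>lborel) = Gamma a * h u" for u
  proof (cases "u > 0")
    case True
    have "(\<integral>s. f (s, u) \<partial>lborel) = P (l - 1) u * (Gamma a * of_real (x + u) powr (-a))"
      unfolding f_eq_s using lap(2)[of a "x + u"] a l x True by simp
    thus ?thesis by (simp add: h_def P_def)
  qed (simp add: f_def P0 h_def)
  \<comment> \<open>\<open>Gamma\<close> takes the value 0 exactly at its poles, the nonpositive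
    integers; \<open>Re a > Re l > 0\<close> excludes them.\<close>
  have nz: "Gamma a \<noteq> 0"
    using a l by (auto simp: Gamma_eq_zero_iff elim!: nonpos_Ints_cases)
  have split: "(\<lambda>(s, u). f (s, u)) = f" by auto
  have "integrable lborel (\<lambda>u. \<integral>s. f (s, u) \<partial>lborel)"
    using lborel_pair.integrable_snd[of "\<lambda>s u. f (s, u)"] int_f by (simp add: split)
  thus "integrable lborel h" unfolding val_s using nz by (rule integrable_mult_leftD)
  have "Gamma a * integral\<^sup>L lborel h = (\<integral>u. (\<integral>s. f (s, u) \<partial>lborel) \<partial>lborel)"
    by (simp add: val_s)
  also have "\<dots> = (\<integral>s. (\<integral>u. f (s, u) \<partial>lborel) \<partial>lborel)"
    using lborel_pair.Fubini_integral[of "\<lambda>s u. f (s, u)"] int_f by (simp add: split)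
  also have "\<dots> = Gamma l * (Gamma (a - l) * of_real x powr (l - a))"
    using lap(2)[of "a - l" x] a x by (simp add: val_u)
  finally show "integral\<^sup>L lborel h = Gamma l * Gamma (a - l) / Gamma a * of_real x powr (l - a)"
    using nz by (simp add: field_simps)
qed


section \<open>Growth of \<open>Gamma\<close> and \<open>rGamma\<close> along arithmetic
  progressions\<close>

text \<open>Telescoping: for \<open>k >= 1\<close> the summand is at most
  \<open>1/(x+k-1) - 1/(x+k)\<close>, and the first one is at most \<open>1/x\<close> because
  \<open>x >= 1\<close>. The subtracted term on the right makes the induction close.\<close>

lemma sum_inverse_squares_shifted_le:
  fixes x :: real
  assumes "x \<ge> 1"
  shows "(\<Sum>k\<le>n. 1 / (x + real k)\<^sup>2) \<le> 2 / x - 1 / (x + real n)"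
proof (induction n)
  case 0
  have "1 / x\<^sup>2 \<le> 1 / x"
    using assms by (simp add: field_simps power2_eq_square)
  thus ?case by simp
next
  case (Suc n)
  have "1 / (x + real (Suc n))\<^sup>2 \<le> 1 / ((x + real n) * (x + real (Suc n)))"
    using assms by (intro divide_left_mono) (auto simp: power2_eq_square intro!: mult_mono)
  also have "\<dots> = 1 / (x + real n) - 1 / (x + real (Suc n))"
    using assms by (simp add: field_simps)
  finally show ?case using Suc.IH by simp
qed

text \<open>
  Compares the Euler products of \<open>1/\<Gamma>\<close> at \<open>z\<close> and \<open>Re z\<close>: each factor grows by at most
  \<open>sqrt (1 + q) \<le> exp (q / 2)\<close> with \<open>q = (Im z / (Re z + k))\<^sup>2\<close>.
\<close>
lemma norm_rGamma_le:
  fixes z :: complex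
  assumes "Re z \<ge> 1"
  shows "norm (rGamma z) \<le> rGamma (Re z) * exp ((Im z)\<^sup>2 / Re z)"
proof (rule tendsto_le[OF sequentially_bot])
  let ?x = "Re z" and ?y = "Im z"
  have factor: "norm (z + of_nat k) \<le> (?x + real k) * exp (?y\<^sup>2 / 2 * (1 / (?x + real k)\<^sup>2))" for k
  proof (rule power2_le_imp_le)
    define q where "q = ?y\<^sup>2 / (?x + real k)\<^sup>2"
    have "(norm (z + of_nat k))\<^sup>2 = (?x + real k)\<^sup>2 * (1 + q)"
      using assms unfolding cmod_power2 q_def by (simp add: field_simps)
    also have "\<dots> \<le> (?x + real k)\<^sup>2 * exp q"
      using exp_ge_add_one_self[of q] by (intro mult_left_mono) auto
    also have "\<dots> = ((?x + real k) * exp (?y\<^sup>2 / 2 * (1 / (?x + real k)\<^sup>2)))\<^sup>2"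
      by (simp add: power_mult_distrib exp_double[symmetric] q_def)
    finally show "(norm (z + of_nat k))\<^sup>2 \<le> \<dots>" .
  qed (use assms in auto)
  have "norm (rGamma_series z n) \<le> rGamma_series ?x n * exp (?y\<^sup>2 / ?x)" for n
  proof -
    have "norm (pochhammer z (n + 1)) = (\<Prod>k\<le>n. norm (z + of_nat k))"
      by (simp add: pochhammer_Suc_prod atLeast0AtMost flip: prod_norm)
    also have "\<dots> \<le> (\<Prod>k\<le>n. (?x + real k) * exp (?y\<^sup>2 / 2 * (1 / (?x + real k)\<^sup>2)))"
      using factor by (intro prod_mono) auto
    also have "\<dots> = pochhammer ?x (n + 1) * exp (?y\<^sup>2 / 2 * (\<Sum>k\<le>n. 1 / (?x + real k)\<^sup>2))"
      by (simp add: prod.distrib pochhammer_Suc_prod atLeast0AtMost sum_distrib_left exp_sum)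
    also have "\<dots> \<le> pochhammer ?x (n + 1) * exp (?y\<^sup>2 / 2 * (2 / ?x))"
    proof (intro mult_left_mono)
      have "(\<Sum>k\<le>n. 1 / (?x + real k)\<^sup>2) \<le> 2 / ?x"
        using sum_inverse_squares_shifted_le[OF assms, of n] assms
        by (smt (verit) divide_nonneg_nonneg of_nat_0_le_iff)
      thus "exp (?y\<^sup>2 / 2 * (\<Sum>k\<le>n. 1 / (?x + real k)\<^sup>2)) \<le> exp (?y\<^sup>2 / 2 * (2 / ?x))"
        by (simp only: exp_le_cancel_iff) (intro mult_left_mono, auto)
    qed (use assms in \<open>auto intro!: pochhammer_nonneg\<close>)
    finally have "norm (pochhammer z (n + 1)) \<le> pochhammer ?x (n + 1) * exp (?y\<^sup>2 / ?x)" by simp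
    thus ?thesis
      by (simp add: rGamma_series_def norm_divide norm_mult norm_fact divide_right_mono)
  qed
  thus "\<forall>\<^sub>F n in sequentially. norm (rGamma_series z n) \<le> rGamma_series ?x n * exp (?y\<^sup>2 / ?x)"
    by simp
qed (auto intro!: tendsto_intros)

text \<open>\<open>Gamma x\<close> is at least the part of Euler's integral over
  \<open>[x, x+1]\<close>, an interval of length 1 on which the integrand is at least
  \<open>x powr (x-1) * exp (-(x+1))\<close>.\<close>

lemma rGamma_real_le:
  fixes x :: real
  assumes "x \<ge> 1"
  shows "rGamma x \<le> exp ((1 - x) * ln x + x + 1)"
proof -
  let ?c = "exp ((x - 1) * ln x - (x + 1))"
  have "((\<lambda>t. ?c) has_integral ?c) {x..x+1}"
    using has_integral_const_real[of ?c x "x + 1"] by simp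
  hence "((\<lambda>t. if t \<in> {x..x+1} then ?c else 0) has_integral ?c) {0..}"
    using assms by (subst has_integral_restrict) auto
  moreover have "((\<lambda>t. t powr (x - 1) / exp t) has_integral Gamma x) {0..}"
    using assms by (intro Gamma_integral_real) auto
  moreover have "(if t \<in> {x..x+1} then ?c else 0) \<le> t powr (x - 1) / exp t" for t
  proof (cases "t \<in> {x..x+1}")
    case that: True
    have "(x - 1) * ln x \<le> (x - 1) * ln t"
      using assms that by (intro mult_left_mono) auto
    hence "?c \<le> exp ((x - 1) * ln t - t)" using that by simp
    thus ?thesis using assms that by (simp add: powr_def exp_diff)
  qed auto
  ultimately have "?c \<le> Gamma x"
    by (rule has_integral_le)
  hence "inverse (Gamma x) \<le> inverse ?c"
    by (intro le_imp_inverse_le) auto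
  thus ?thesis
    by (simp add: rGamma_inverse_Gamma exp_minus[symmetric] algebra_simps)
qed

text \<open>In Euler's integral for \<open>Gamma (x+1)\<close>, one factor \<open>exp (-t/2)\<close>
  is spent on \<open>t powr x\<close>: by \<open>ln s <= s - 1\<close> at \<open>s = t/(2*x)\<close>
  their product is at most \<open>(2*x) powr x\<close>. The other factor integrates to 2. Starting
  from \<open>x + 1\<close> avoids negative exponents for \<open>x < 1\<close>.\<close>

lemma Gamma_real_le:
  fixes x :: real
  assumes "x > 0"
  shows "Gamma x \<le> 2 / x * exp (x * ln (2 * x))"
proof -
  have "((\<lambda>t. t powr (x + 1 - 1) / exp t) has_integral Gamma (x + 1)) {0..}"
    using assms by (intro Gamma_integral_real) auto
  moreover have "((\<lambda>t. exp (x * ln (2 * x)) * exp (- (1/2) * t)) has_integral exp (x * ln (2 * x)) * (exp (- (1/2) * 0) / (1/2))) {0..}"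
    by (intro has_integral_mult_right has_integral_exp_minus_to_infinity) auto
  moreover have "t powr (x + 1 - 1) / exp t \<le> exp (x * ln (2 * x)) * exp (- (1/2) * t)" if "t \<in> {0..}" for t
  proof (cases "t = 0")
    case False
    hence t: "t > 0" using that by auto
    have "ln (t / (2 * x)) \<le> t / (2 * x) - 1" using t assms by (intro ln_le_minus_one) auto
    hence "x * ln t \<le> x * (ln (2 * x) + t / (2 * x))"
      using t assms by (intro mult_left_mono) (auto simp: ln_div)
    also have "\<dots> = x * ln (2 * x) + t / 2" using assms by (simp add: field_simps)
    finally show ?thesis using t
      by (simp add: powr_def mult_exp_exp flip: exp_diff)
  qed (use assms in auto)
  ultimately have "Gamma (x + 1) \<le> exp (x * ln (2 * x)) * (exp (- (1/2) * 0) / (1/2))"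
    by (rule has_integral_le)
  moreover have "Gamma (x + 1) = x * Gamma x"
    using assms by (intro Gamma_plus1) auto
  ultimately show ?thesis using assms by (simp add: field_simps)
qed

text \<open>Triangle inequality in Euler's integral, since \<open>t powr (z-1)\<close> has modulus
  \<open>t powr (Re z - 1)\<close>.\<close>

lemma norm_Gamma_le_Gamma_Re:
  assumes "Re z > 0"
  shows "norm (Gamma z) \<le> Gamma (Re z)"
proof -
  note i1 = Gamma_integral_complex[OF assms] and i2 = Gamma_integral_real[OF assms]
  have "norm (integral {0..} (\<lambda>t. complex_of_real t powr (z - 1) / of_real (exp t))) 
        \<le> integral {0..} (\<lambda>t. t powr (Re z - 1) / exp t)"
    using i1 i2
    by (intro integral_norm_bound_integral) 
       (auto simp: norm_divide norm_powr_real_powr has_integral_iff)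
  thus ?thesis using i1 i2 by (simp add: integral_unique)
qed

text \<open>Only the coefficient \<open>k\<close> of \<open>n ln n\<close> has to be exact; every
  other contribution to the exponent is linear in \<open>n\<close> because
  \<open>ln n <= n\<close>.\<close>

lemma norm_Gamma_linear_growth:
  fixes g :: complex and k :: real
  assumes "Re g > 0" "k > 0"
  shows "\<exists>K. \<forall>n\<ge>1. norm (Gamma (g + of_real k * of_nat n)) \<le> exp (k * (real n * ln (real n)) + K * real n)"
proof -
  \<comment> \<open>Chosen so that \<open>x <= C * n\<close> for \<open>n >= 1\<close> and
    \<open>ln (2 * C)\<close> is positive.\<close>
  define C where "C = 1 + Re g + k"
  have C: "C \<ge> 1" using assms by (simp add: C_def)
  show ?thesis
  proof (intro exI allI impI)
    fix n :: nat assume n: "n \<ge> 1"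
    define x where "x = Re g + k * real n"
    have ln_n: "ln (real n) \<ge> 0" "ln (real n) \<le> real n"
      using n ln_bound[of "real n"] by auto
    have x: "x \<ge> Re g" "x > 0" using assms by (auto simp: x_def add_pos_nonneg)
    have "Re g * 1 \<le> Re g * real n" using assms n by (intro mult_left_mono) auto
    hence xC: "x \<le> C * real n" by (simp add: x_def C_def algebra_simps)
    have "norm (Gamma (g + of_real k * of_nat n)) \<le> Gamma x"
      using norm_Gamma_le_Gamma_Re[of "g + of_real k * of_nat n"] x by (simp add: x_def)
    also have "\<dots> \<le> 2 / x * exp (x * ln (2 * x))"
      by (rule Gamma_real_le) fact
    also have "\<dots> \<le> exp (2 / Re g * real n) * exp (k * (real n * ln (real n)) + Re g * real n + C * real n * ln (2 * C))"
    proof (intro mult_mono)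
      have "2 / x \<le> 2 / Re g" using x assms by (intro divide_left_mono) auto
      also have "\<dots> \<le> exp (2 / Re g)" using exp_ge_add_one_self[of "2 / Re g"] by linarith
      also have "\<dots> \<le> exp (2 / Re g * real n)" using n assms by (simp add: field_simps)
      finally show "2 / x \<le> exp (2 / Re g * real n)" .
    next
      have "x * ln (2 * x) \<le> x * ln (2 * C * real n)"
        using x xC by (intro mult_left_mono) auto
      also have "\<dots> = x * ln (real n) + x * ln (2 * C)"
        using n C by (simp add: ln_mult algebra_simps)
      also have "\<dots> \<le> k * (real n * ln (real n)) + Re g * real n + C * real n * ln (2 * C)"
      proof -
        have "x * ln (2 * C) \<le> C * real n * ln (2 * C)" 
          using xC C by (intro mult_right_mono) auto
        moreover have "Re g * ln (real n) \<le> Re g * real n"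
          using assms ln_n by (intro mult_left_mono) auto
        ultimately show ?thesis by (simp add: x_def algebra_simps)
      qed
      finally show "exp (x * ln (2 * x)) \<le> exp (k * (real n * ln (real n)) + Re g * real n + C * real n * ln (2 * C))"
        by simp
    qed (use x in auto)
    also have "\<dots> = exp (k * (real n * ln (real n)) + (2 / Re g + Re g + C * ln (2 * C)) * real n)"
      by (simp add: mult_exp_exp algebra_simps)
    finally show "norm (Gamma (g + of_real k * of_nat n)) \<le> \<dots>" .
  qed
qed

lemma rGamma_eq_pochhammer_times: "rGamma z = pochhammer z n * rGamma (z + of_nat n)"
  for z :: complex
proof (induction n)
  case (Suc n)
  have "rGamma z = pochhammer z n * ((z + of_nat n) * rGamma (z + of_nat n + 1))"
    unfolding rGamma_plus1 by (rule Suc.IH)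
  thus ?case by (simp add: pochhammer_Suc add_ac mult_ac)
qed auto

text \<open>With \<open>w = z + L*n\<close> far enough to the right, the Pochhammer factor costs
  \<open>L n ln n\<close> in the exponent while \<open>rGamma w\<close> gains
  \<open>(Re a + L) n ln n\<close>; the shift cancels and \<open>- Re a\<close> remains.\<close>

lemma norm_rGamma_linear_growth:
  fixes a b :: complex
  shows "\<exists>K. \<forall>n\<ge>1. norm (rGamma (a * of_nat n + b)) \<le> exp (- Re a * (real n * ln (real n)) + K * real n)"
proof -
  \<comment> \<open>Large enough for \<open>Re w >= n\<close> at every \<open>n >= 1\<close>,
    whatever the signs of \<open>Re a\<close> and \<open>Re b\<close>.\<close>
  obtain L :: nat where L: "real L \<ge> 1 + \<bar>Re a\<bar> + \<bar>Re b\<bar>"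
    using real_arch_simple by blast
  define C where "C = norm a + norm b + real L"
  have C: "C \<ge> 1" using L norm_ge_zero[of a] norm_ge_zero[of b] unfolding C_def by linarith
  show ?thesis
  proof (intro exI allI impI)
    fix n :: nat assume n: "n \<ge> 1"
    define z where "z = a * of_nat n + b"
    define w where "w = z + of_nat (L * n)"
    have ln_n: "ln (real n) \<ge> 0" "ln (real n) \<le> real n"
      using n ln_bound[of "real n"] by auto
    have "norm b * 1 \<le> norm b * real n" using n by (intro mult_left_mono) auto
    hence z: "norm z \<le> (norm a + norm b) * real n"
      using norm_triangle_ineq[of "a * of_nat n" b] by (simp add: z_def norm_mult algebra_simps)
    have w: "norm w \<le> C * real n"
      using z norm_triangle_ineq[of z "of_nat (L * n)"]
      unfolding w_def C_def norm_of_nat by (simp add: algebra_simps)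
    have Re_w: "Re w = Re a * real n + Re b + real L * real n"
      by (simp add: w_def z_def)
    have "(1 + \<bar>Re a\<bar> + \<bar>Re b\<bar>) * real n \<le> real L * real n"
      using L by (intro mult_right_mono) auto
    moreover have "- \<bar>Re a\<bar> * real n \<le> Re a * real n"
      by (intro mult_right_mono) auto
    moreover have "\<bar>Re b\<bar> * 1 \<le> \<bar>Re b\<bar> * real n"
      using n by (intro mult_left_mono) auto
    ultimately have Re_w_ge: "Re w \<ge> real n"
      unfolding Re_w by (simp add: algebra_simps)
    hence Re_w1: "Re w \<ge> 1" using n by linarith
    \<comment> \<open>Each of the \<open>L * n\<close> factors \<open>z + k\<close> has modulus at
      most \<open>C * n\<close>.\<close>
    have poch: "norm (pochhammer z (L * n)) \<le> exp (real L * real n * (ln C + ln (real n)))"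
    proof -
      have "norm (pochhammer z (L * n)) = (\<Prod>k<L*n. norm (z + of_nat k))"
        by (simp add: pochhammer_prod atLeast0LessThan flip: prod_norm)
      also have "\<dots> \<le> (\<Prod>k<L*n. C * real n)"
      proof (intro prod_mono conjI)
        fix k assume "k \<in> {..<L * n}"
        hence "real k \<le> real L * real n" by (metis lessThan_iff less_imp_le of_nat_le_iff of_nat_mult)
        thus "norm (z + of_nat k) \<le> C * real n"
          using z norm_triangle_ineq[of z "of_nat k"] unfolding norm_of_nat
          by (simp add: C_def algebra_simps)
      qed auto
      also have "\<dots> = exp (ln C + ln (real n)) ^ (L * n)"
        using C n by (simp add: exp_add)
      also have "\<dots> = exp (real L * real n * (ln C + ln (real n)))"
        by (simp add: exp_of_nat_mult[symmetric])
      finally show ?thesis .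
    qed
    \<comment> \<open>The numerator is quadratic in \<open>n\<close>, but \<open>Re w >= n\<close>
      brings the correction term of \<open>norm_rGamma_le\<close> down to linear size.\<close>
    have im: "(Im w)\<^sup>2 / Re w \<le> C\<^sup>2 * real n"
    proof -
      have "(Im w)\<^sup>2 \<le> (C * real n)\<^sup>2"
        using abs_Im_le_cmod[of w] w by (metis abs_ge_zero order.trans power2_abs power_mono)
      hence "(Im w)\<^sup>2 / Re w \<le> (C * real n)\<^sup>2 / real n"
        using Re_w_ge n by (intro frac_le) auto
      also have "\<dots> = C\<^sup>2 * real n" using n by (simp add: power2_eq_square)
      finally show ?thesis .
    qed
    have "norm (rGamma w) \<le> rGamma (Re w) * exp ((Im w)\<^sup>2 / Re w)"
      by (rule norm_rGamma_le) fact
    also have "\<dots> \<le> exp ((1 - Re w) * ln (Re w) + Re w + 1) * exp (C\<^sup>2 * real n)"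
      using rGamma_real_le[OF Re_w1] im by (intro mult_mono) auto
    also have "\<dots> \<le> exp ((1 - Re w) * ln (real n) + C * real n + real n) * exp (C\<^sup>2 * real n)"
    proof -
      \<comment> \<open>As \<open>1 - Re w\<close> is nonpositive, the lower bound on
        \<open>Re w\<close> gives an upper bound here.\<close>
      have "(1 - Re w) * ln (Re w) \<le> (1 - Re w) * ln (real n)"
        using Re_w1 Re_w_ge n by (intro mult_left_mono_neg) auto
      moreover have "Re w \<le> C * real n" using complex_Re_le_cmod[of w] w by linarith
      ultimately show ?thesis using n by (intro mult_right_mono) auto
    qed
    finally have rG: "norm (rGamma w) \<le> \<dots>" .
    have "norm (rGamma z) = norm (pochhammer z (L * n)) * norm (rGamma w)"
      using rGamma_eq_pochhammer_times[of z "L * n"] by (simp add: w_def norm_mult)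
    also have "\<dots> \<le> exp (real L * real n * (ln C + ln (real n))) *
        (exp ((1 - Re w) * ln (real n) + C * real n + real n) * exp (C\<^sup>2 * real n))"
      by (intro mult_mono poch rG) auto
    \<comment> \<open>The two \<open>L n ln n\<close> terms cancel; the leftover multiple of
      \<open>ln n\<close> is absorbed into the linear part next.\<close>
    also have "\<dots> = exp (- Re a * (real n * ln (real n)) + (real L * ln C + C + 1 + C\<^sup>2) * real n
         + (1 - Re b) * ln (real n))"
      by (simp add: mult_exp_exp Re_w algebra_simps)
    also have "\<dots> \<le> exp (- Re a * (real n * ln (real n)) + (real L * ln C + C + 1 + C\<^sup>2) * real n
         + (1 + \<bar>Re b\<bar>) * real n)"
    proof -
      have "(1 - Re b) * ln (real n) \<le> (1 + \<bar>Re b\<bar>) * real n"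
        using ln_n by (intro mult_mono) auto
      thus ?thesis by simp
    qed
    also have "\<dots> = exp (- Re a * (real n * ln (real n)) + (real L * ln C + C + 1 + C\<^sup>2 + 1 + \<bar>Re b\<bar>) * real n)"
      by (simp add: algebra_simps)
    finally show "norm (rGamma (a * of_nat n + b)) \<le> \<dots>" by (simp add: z_def)
  qed
qed

lemma norm_prod_rGamma_linear_growth:
  fixes a b :: "'i \<Rightarrow> complex"
  assumes "finite J"
  shows "\<exists>K. \<forall>n\<ge>1. norm (\<Prod>j\<in>J. rGamma (a j * of_nat n + b j))
           \<le> exp (- (\<Sum>j\<in>J. Re (a j)) * (real n * ln (real n)) + K * real n)"
proof -
  have "\<forall>j. \<exists>K. \<forall>n\<ge>1. norm (rGamma (a j * of_nat n + b j))
      \<le> exp (- Re (a j) * (real n * ln (real n)) + K * real n)"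
    using norm_rGamma_linear_growth by blast
  then obtain K where K: "\<And>j n. n \<ge> 1 \<Longrightarrow>
      norm (rGamma (a j * of_nat n + b j)) \<le> exp (- Re (a j) * (real n * ln (real n)) + K j * real n)"
    unfolding choice_iff by blast
  have "norm (\<Prod>j\<in>J. rGamma (a j * of_nat n + b j))
      \<le> exp (- (\<Sum>j\<in>J. Re (a j)) * (real n * ln (real n)) + (\<Sum>j\<in>J. K j) * real n)" if "n \<ge> 1" for n
  proof -
    have "norm (\<Prod>j\<in>J. rGamma (a j * of_nat n + b j))
        \<le> (\<Prod>j\<in>J. exp (- Re (a j) * (real n * ln (real n)) + K j * real n))"
      unfolding prod_norm[symmetric] using K[OF that] by (intro prod_mono) auto
    also have "\<dots> = exp (\<Sum>j\<in>J. - Re (a j) * (real n * ln (real n)) + K j * real n)"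
      using assms by (simp add: exp_sum)
    also have "(\<Sum>j\<in>J. - Re (a j) * (real n * ln (real n)) + K j * real n) =
        - (\<Sum>j\<in>J. Re (a j)) * (real n * ln (real n)) + (\<Sum>j\<in>J. K j) * real n"
      by (simp add: sum.distrib sum_subtractf sum_distrib_right)
    finally show ?thesis .
  qed
  thus ?thesis by blast
qed

text \<open>Once \<open>ln n >= (K + 1) / e\<close>, the term is at most
  \<open>exp (-n)\<close>.\<close>

lemma summable_exp_neg_n_ln_n:
  fixes e K :: real
  assumes "e > 0"
  shows "summable (\<lambda>n. exp (- e * (real n * ln (real n)) + K * real n))"
proof (rule summable_comparison_test_ev)
  have "summable (\<lambda>n. exp (-1 :: real) ^ n)"
    by (rule summable_geometric) simp
  thus "summable (\<lambda>n. exp (- real n))"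
    by (simp add: exp_of_nat_mult[symmetric])
  have "filterlim (\<lambda>n. ln (real n)) at_top sequentially"
    by (rule filterlim_compose[OF ln_at_top filterlim_real_sequentially])
  hence "\<forall>\<^sub>F n in sequentially. ln (real n) \<ge> (K + 1) / e"
    by (simp add: filterlim_at_top)
  thus "\<forall>\<^sub>F n in sequentially. norm (exp (- e * (real n * ln (real n)) + K * real n)) \<le> exp (- real n)"
  proof eventually_elim
    case (elim n)
    hence "K + 1 \<le> e * ln (real n)" using assms by (simp add: field_simps)
    hence "(K + 1) * real n \<le> e * ln (real n) * real n" by (intro mult_right_mono) auto
    thus ?case by (simp add: algebra_simps)
  qed
qed


section \<open>Termwise fractional integration of the Bessel series\<close>

text \<open>The translation \<open>u = t - x\<close> reduces this to
  \<open>beta_integral_half_line\<close>; the form \<open>-x + 1 * t\<close> in the proof matches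
  the affine substitution rule.\<close>

lemma set_integrable_rl_right_integrand_powr:
  fixes a l :: complex and x :: real
  assumes x: "x > 0" and l: "Re l > 0" and a: "Re a > Re l"
  shows "set_integrable lborel {x<..} (rl_right_integrand l (\<lambda>t. of_real t powr (-a)) x)"
    and "(LINT t:{x<..}|lborel. rl_right_integrand l (\<lambda>t. of_real t powr (-a)) x t)
           = Gamma l * Gamma (a - l) / Gamma a * of_real x powr (l - a)"
proof -
  define h where "h = (\<lambda>u. complex_of_real (x + u) powr (-a) * (indicator {0<..} u *\<^sub>R (of_real u powr (l - 1))))"
  note h = beta_integral_half_line[OF assms, folded h_def]
  have eq: "indicator {x<..} t *\<^sub>R rl_right_integrand l (\<lambda>t. of_real t powr (-a)) x t = h (-x + 1 * t)" for t
    by (auto simp: rl_right_integrand_def h_def indicator_def powr_minus_divide[symmetric])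
       (simp add: powr_diff field_simps)
  show "set_integrable lborel {x<..} (rl_right_integrand l (\<lambda>t. of_real t powr (-a)) x)"
    unfolding set_integrable_def eq using h(1) by (intro lborel_integrable_real_affine) auto
  show "(LINT t:{x<..}|lborel. rl_right_integrand l (\<lambda>t. of_real t powr (-a)) x t)
           = Gamma l * Gamma (a - l) / Gamma a * of_real x powr (l - a)"
    using lborel_integral_real_affine[of 1 h "-x"]
    unfolding set_lebesgue_integral_def eq h(2) by simp
qed

text \<open>Isolates the power series coefficient, so that it can leave the integral and terms at
  different arguments can be compared.\<close>

lemma multiindex_bessel_term_eq:
  "multiindex_bessel_term m \<alpha> \<beta> \<gamma> \<kappa> b c z n = multiindex_bessel_term m \<alpha> \<beta> \<gamma> \<kappa> b c 1 n * z ^ n"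
  by (simp add: multiindex_bessel_term_def)

lemma summable_norm_multiindex_bessel_term:
  assumes "\<kappa> > 0" "(\<Sum>j=1..m. Re (\<alpha> j)) > \<kappa> - 1" "Re \<gamma> > 0"
  shows "summable (\<lambda>n. norm (multiindex_bessel_term m \<alpha> \<beta> \<gamma> \<kappa> b c z n))"
proof -
  \<comment> \<open>The net coefficient of \<open>- n ln n\<close>: the reciprocal Gamma product
    contributes the sum, \<open>1/n!\<close> contributes 1, and the Gamma factor in the numerator
    takes away \<open>\<kappa>\<close>. It is positive by hypothesis.\<close>
  define e where "e = (\<Sum>j=1..m. Re (\<alpha> j)) - \<kappa> + 1"
  obtain K1 where K1: "\<And>n. n \<ge> 1 \<Longrightarrow>
      norm (Gamma (\<gamma> + of_real \<kappa> * of_nat n)) \<le> exp (\<kappa> * (real n * ln (real n)) + K1 * real n)"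
    using norm_Gamma_linear_growth[OF assms(3,1)] by blast
  obtain K2 where K2: "\<And>n. n \<ge> 1 \<Longrightarrow>
      norm (\<Prod>j=1..m. rGamma (\<alpha> j * of_nat n + (\<beta> j + (b + 1) / 2)))
        \<le> exp (- (\<Sum>j=1..m. Re (\<alpha> j)) * (real n * ln (real n)) + K2 * real n)"
    using norm_prod_rGamma_linear_growth[of "{1..m}" \<alpha> "\<lambda>j. \<beta> j + (b + 1) / 2"] by blast
  \<comment> \<open>This handles \<open>1/n!\<close>, which equals
    \<open>rGamma (n + 1)\<close>.\<close>
  obtain K3 where K3: "\<And>n. n \<ge> 1 \<Longrightarrow>
      norm (rGamma (1 * of_nat n + 1 :: complex)) \<le> exp (- Re 1 * (real n * ln (real n)) + K3 * real n)"
    using norm_rGamma_linear_growth[of 1 1] by blast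
  define K where "K = K1 + K2 + K3 + norm c + norm z"
  have pow: "norm w ^ n \<le> exp (norm w * real n)" for w :: complex and n
  proof -
    have "norm w \<le> exp (norm w)"
      using exp_ge_add_one_self[of "norm w"] by linarith
    hence "norm w ^ n \<le> exp (norm w) ^ n"
      by (intro power_mono) auto
    thus ?thesis by (simp add: exp_of_nat_mult[symmetric] mult.commute)
  qed
  have bound: "norm (norm (multiindex_bessel_term m \<alpha> \<beta> \<gamma> \<kappa> b c z n)) \<le>
      exp (- e * (real n * ln (real n)) + K * real n) / norm (Gamma \<gamma>)" if n: "n \<ge> 1" for n
  proof -
    have fact_eq: "norm (1 / fact n :: complex) = norm (rGamma (1 * of_nat n + 1 :: complex))"
      using Gamma_fact[of n, where ?'a = complex] by (simp add: rGamma_inverse_Gamma inverse_eq_divide add.commute)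
    have "norm (multiindex_bessel_term m \<alpha> \<beta> \<gamma> \<kappa> b c z n) =
      norm c ^ n * norm (Gamma (\<gamma> + of_real \<kappa> * of_nat n))
       * norm (\<Prod>j=1..m. rGamma (\<alpha> j * of_nat n + (\<beta> j + (b + 1) / 2)))
       * (norm z ^ n * norm (1 / fact n :: complex)) / norm (Gamma \<gamma>)"
      by (simp add: multiindex_bessel_term_def gpochhammer_def norm_mult norm_divide norm_power add.assoc)
    also have "\<dots> \<le> exp (norm c * real n) * exp (\<kappa> * (real n * ln (real n)) + K1 * real n)
       * exp (- (\<Sum>j=1..m. Re (\<alpha> j)) * (real n * ln (real n)) + K2 * real n)
       * (exp (norm z * real n) * exp (- Re 1 * (real n * ln (real n)) + K3 * real n)) / norm (Gamma \<gamma>)"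
      unfolding fact_eq
      by (intro divide_right_mono mult_mono pow K1[OF n] K2[OF n] K3[OF n]) auto
    also have "\<dots> = exp (- e * (real n * ln (real n)) + K * real n) / norm (Gamma \<gamma>)"
      by (simp add: mult_exp_exp e_def K_def algebra_simps)
    finally show ?thesis by simp
  qed
  have "summable (\<lambda>n. exp (- e * (real n * ln (real n)) + K * real n) / norm (Gamma \<gamma>))"
    using assms(2) by (intro summable_divide summable_exp_neg_n_ln_n) (simp add: e_def)
  thus ?thesis
    using bound by (rule summable_comparison_test'[where N = 1])
qed

text \<open>\<open>Gamma \<gamma>\<close> clears the denominator of the Pochhammer symbol, and the
  pairs \<open>(\<delta> - l, 1)\<close> and \<open>(\<delta>, 1)\<close> supply the Gamma quotient
  that the beta integral produces at \<open>a = \<delta> + n\<close>.\<close>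

lemma fox_wright_term_eq_multiindex_bessel_term:
  assumes "Gamma \<gamma> \<noteq> 0"
  shows "fox_wright_term [(\<gamma>, complex_of_real \<kappa>), (\<delta> - l, 1)]
           (map (\<lambda>j. (\<beta> j + (b + 1) / 2, \<alpha> j)) [1..<Suc m] @ [(\<delta>, 1)]) (c * z) n =
         Gamma \<gamma> * multiindex_bessel_term m \<alpha> \<beta> \<gamma> \<kappa> b c z n * (Gamma (\<delta> + of_nat n - l) / Gamma (\<delta> + of_nat n))"
proof -
  have "prod_list (map (\<lambda>j. rGamma (\<beta> j + (b + 1) / 2 + \<alpha> j * of_nat n)) [1..<Suc m]) =
      (\<Prod>j\<in>set [1..<Suc m]. rGamma (\<beta> j + (b + 1) / 2 + \<alpha> j * of_nat n))"
    by (rule prod.distinct_set_conv_list[symmetric]) simp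
  also have "set [1..<Suc m] = {1..m}" by auto
  finally have *: "prod_list (map (\<lambda>j. rGamma (\<beta> j + (b + 1) / 2 + \<alpha> j * of_nat n)) [1..<Suc m]) =
     (\<Prod>j=1..m. rGamma (\<alpha> j * of_nat n + \<beta> j + (b + 1) / 2))"
    by (simp add: add_ac)
  have quotient: "Gamma (\<delta> + of_nat n - l) / Gamma (\<delta> + of_nat n) =
      Gamma (\<delta> - l + of_nat n) * rGamma (\<delta> + of_nat n)"
    by (simp only: rGamma_inverse_Gamma divide_inverse diff_add_eq)
  have "fox_wright_term [(\<gamma>, complex_of_real \<kappa>), (\<delta> - l, 1)]
           (map (\<lambda>j. (\<beta> j + (b + 1) / 2, \<alpha> j)) [1..<Suc m] @ [(\<delta>, 1)]) (c * z) n =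
       Gamma (\<gamma> + of_real \<kappa> * of_nat n) * Gamma (\<delta> - l + of_nat n) *
       (prod_list (map (\<lambda>j. rGamma (\<beta> j + (b + 1) / 2 + \<alpha> j * of_nat n)) [1..<Suc m]) * rGamma (\<delta> + of_nat n))
       * ((c * z) ^ n / fact n)"
    by (simp add: fox_wright_term_def o_def del: upt_Suc)
  also have "\<dots> = Gamma \<gamma> * multiindex_bessel_term m \<alpha> \<beta> \<gamma> \<kappa> b c z n * (Gamma (\<delta> + of_nat n - l) / Gamma (\<delta> + of_nat n))"
    unfolding * quotient using assms
    by (simp add: multiindex_bessel_term_def gpochhammer_def power_mult_distrib)
  finally show ?thesis .
qed

text \<open>\<open>suminf\<close> and the Lebesgue integral are total operators, so the conclusion
  also asserts convergence of both series and integrability; the identity is then one between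
  genuine values.\<close>

theorem theorem2:
  fixes m :: nat and \<alpha> \<beta> :: "nat \<Rightarrow> complex" and \<gamma> b c l \<delta> :: complex and \<kappa> x :: real
  assumes "\<kappa> > 0"
    and "(\<Sum>j=1..m. Re (\<alpha> j)) > max 0 (\<kappa> - 1)"
    and "\<forall>j\<in>{1..m}. Re (\<beta> j) > 0"
    and "Re \<gamma> > 0"
    and "Re \<delta> > Re l" and "Re l > 0"
    and "x > 0"
  shows "(\<forall>t>x. summable (multiindex_bessel_term m \<alpha> \<beta> \<gamma> \<kappa> b c (complex_of_real (1 / t)))) \<and>
    set_integrable lborel {x<..}
      (rl_right_integrand l
        (\<lambda>t. complex_of_real t powr (- \<delta>)
              * multiindex_bessel m \<alpha> \<beta> \<gamma> \<kappa> b c (complex_of_real (1 / t))) x) \<and>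
    summable
      (fox_wright_term
        [(\<gamma>, complex_of_real \<kappa>), (\<delta> - l, 1)]
        (map (\<lambda>j. (\<beta> j + (b + 1) / 2, \<alpha> j)) [1..<Suc m] @ [(\<delta>, 1)])
        (c / complex_of_real x)) \<and>
    rl_right_integral l
      (\<lambda>t. complex_of_real t powr (- \<delta>)
            * multiindex_bessel m \<alpha> \<beta> \<gamma> \<kappa> b c (complex_of_real (1 / t))) x
      = complex_of_real x powr (l - \<delta>) / Gamma \<gamma>
        * fox_wright
            [(\<gamma>, complex_of_real \<kappa>), (\<delta> - l, 1)]
            (map (\<lambda>j. (\<beta> j + (b + 1) / 2, \<alpha> j)) [1..<Suc m] @ [(\<delta>, 1)])
            (c / complex_of_real x)"
proof -
  let ?T = "multiindex_bessel_term m \<alpha> \<beta> \<gamma> \<kappa> b c"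
  let ?B = "multiindex_bessel m \<alpha> \<beta> \<gamma> \<kappa> b c"
  define W where "W = fox_wright_term [(\<gamma>, complex_of_real \<kappa>), (\<delta> - l, 1)]
        (map (\<lambda>j. (\<beta> j + (b + 1) / 2, \<alpha> j)) [1..<Suc m] @ [(\<delta>, 1)]) (c / complex_of_real x)"
  note x = \<open>x > 0\<close>
  have nz: "Gamma \<gamma> \<noteq> 0" "Gamma l \<noteq> 0" "complex_of_real x powr (l - \<delta>) \<noteq> 0"
    using assms by (auto simp: Gamma_eq_zero_iff elim!: nonpos_Ints_cases)
  have sum_T: "summable (\<lambda>n. norm (?T z n))" for z
    using assms by (intro summable_norm_multiindex_bessel_term) auto
  define G where "G = (\<lambda>a t. indicator {x<..} t *\<^sub>R rl_right_integrand l (\<lambda>t. of_real t powr (-a)) x t)"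
  have G: "integrable lborel (G (\<delta> + of_nat n))"
    "integral\<^sup>L lborel (G (\<delta> + of_nat n)) = Gamma l * Gamma (\<delta> + of_nat n - l) / Gamma (\<delta> + of_nat n)
         * of_real x powr (l - (\<delta> + of_nat n))" for n
    using set_integrable_rl_right_integrand_powr[of x l "\<delta> + of_nat n"] assms
    unfolding G_def set_integrable_def set_lebesgue_integral_def by auto
  \<comment> \<open>The factor \<open>(1/t)^n\<close> of the \<open>n\<close>-th term is absorbed
    into the exponent of the kernel, making \<open>F n\<close> a constant times a beta integrand.
    \<open>F_eq\<close> gives the other reading, with a fixed kernel, for summing over
    \<open>n\<close>.\<close>
  define F where "F = (\<lambda>n t. ?T 1 n * G (\<delta> + of_nat n) t)"
  have F_eq: "F n t = G \<delta> t * ?T (complex_of_real (1 / t)) n" for n t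
  proof (cases "t > x")
    case True
    hence "complex_of_real t powr (- (\<delta> + of_nat n)) = of_real t powr (-\<delta>) * of_real (1 / t) ^ n"
      using x by (simp add: powr_diff powr_nat' power_divide)
    thus ?thesis
      using multiindex_bessel_term_eq[of m \<alpha> \<beta> \<gamma> \<kappa> b c "of_real (1 / t)" n]
      by (simp add: F_def G_def rl_right_integrand_def)
  qed (simp add: F_def G_def)
  have sumF: "summable (\<lambda>n. norm (F n t))" for t
    unfolding F_eq norm_mult by (intro summable_mult sum_T)
  have int_F: "integrable lborel (F n)" for n
    unfolding F_def using G(1) by simp
  \<comment> \<open>For \<open>t > x\<close> the \<open>n\<close>-th term at \<open>1/t\<close> is
    dominated by that at \<open>1/x\<close>, so a single integrable function with summable
    coefficients majorizes all \<open>F n\<close>.\<close>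
  have norm_F: "norm (F n t) \<le> norm (?T (of_real (1 / x)) n) * norm (G \<delta> t)" for n t
  proof (cases "t > x")
    case True
    have "norm (?T (of_real (1 / t)) n) \<le> norm (?T (of_real (1 / x)) n)"
      using True x
      by (subst (1 2) multiindex_bessel_term_eq)
         (auto simp: norm_mult norm_power norm_divide intro!: mult_left_mono power_mono divide_left_mono)
    thus ?thesis unfolding F_eq norm_mult by (metis mult.commute mult_right_mono norm_ge_zero)
  qed (simp add: F_eq G_def)
  have int_G: "integrable lborel (G \<delta>)" using G(1)[of 0] by simp
  have sum_int: "summable (\<lambda>n. \<integral>t. norm (F n t) \<partial>lborel)"
  proof (rule summable_comparison_test')
    show "summable (\<lambda>n. norm (?T (of_real (1 / x)) n) * (\<integral>t. norm (G \<delta> t) \<partial>lborel))"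
      by (intro summable_mult2 sum_T)
    show "norm (\<integral>t. norm (F n t) \<partial>lborel) \<le> norm (?T (of_real (1 / x)) n) * (\<integral>t. norm (G \<delta> t) \<partial>lborel)" for n
    proof -
      have "(\<integral>t. norm (F n t) \<partial>lborel) \<le> (\<integral>t. norm (?T (of_real (1 / x)) n) * norm (G \<delta> t) \<partial>lborel)"
        using int_F int_G norm_F by (intro integral_mono) auto
      thus ?thesis by simp
    qed
  qed
  have suminf_F: "(\<Sum>n. F n t) = indicator {x<..} t *\<^sub>R
      rl_right_integrand l (\<lambda>t. of_real t powr (- \<delta>) * ?B (of_real (1 / t))) x t" for t
    unfolding F_eq multiindex_bessel_def
    using suminf_mult[OF summable_norm_cancel[OF sum_T], of "G \<delta> t" "of_real (1 / t)"]
    by (simp add: G_def rl_right_integrand_def)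
  note interchange = AE_I2[of lborel "\<lambda>t. summable (\<lambda>n. norm (F n t))", OF sumF]
  have int_sum: "integrable lborel (\<lambda>t. \<Sum>n. F n t)"
    by (rule integrable_suminf[OF int_F interchange sum_int])
  have sums_sum: "(\<lambda>n. integral\<^sup>L lborel (F n)) sums (\<integral>t. (\<Sum>n. F n t) \<partial>lborel)"
    by (rule sums_integral[OF int_F interchange sum_int])
  have val_F: "integral\<^sup>L lborel (F n) = Gamma l * (of_real x powr (l - \<delta>) / Gamma \<gamma>) * W n" for n
  proof -
    \<comment> \<open>The split-off power \<open>(1/x)^n\<close> becomes part of the Fox-Wright
      argument \<open>c/x\<close>.\<close>
    have "complex_of_real x powr (l - (\<delta> + of_nat n)) = of_real x powr (l - \<delta>) * of_real (1 / x) ^ n"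
      using x by (simp add: diff_diff_eq[symmetric] powr_diff powr_nat' power_divide)
    moreover have "W n = Gamma \<gamma> * ?T (of_real (1 / x)) n * (Gamma (\<delta> + of_nat n - l) / Gamma (\<delta> + of_nat n))"
      using fox_wright_term_eq_multiindex_bessel_term[OF nz(1), of \<kappa> \<delta> l \<beta> b \<alpha> m c "of_real (1 / x)" n]
      by (simp add: W_def)
    ultimately show ?thesis
      using nz multiindex_bessel_term_eq[of m \<alpha> \<beta> \<gamma> \<kappa> b c "of_real (1 / x)" n]
      by (simp add: F_def G(2))
  qed
  \<comment> \<open>Convergence of the Fox-Wright series comes from termwise integration itself: up
    to one nonzero constant, its terms are the integrals of the \<open>F n\<close>.\<close>
  have sums_W: "W sums ((\<integral>t. (\<Sum>n. F n t) \<partial>lborel) / (Gamma l * (of_real x powr (l - \<delta>) / Gamma \<gamma>)))"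
    using sums_divide[OF sums_sum, of "Gamma l * (of_real x powr (l - \<delta>) / Gamma \<gamma>)"] nz
    unfolding val_F by simp
  have "rl_right_integral l (\<lambda>t. of_real t powr (- \<delta>) * ?B (of_real (1 / t))) x
      = of_real x powr (l - \<delta>) / Gamma \<gamma> * (\<Sum>n. W n)"
    using nz sums_unique[OF sums_W]
    unfolding rl_right_integral_def set_lebesgue_integral_def suminf_F[symmetric]
    by (simp add: field_simps)
  moreover have "set_integrable lborel {x<..}
      (rl_right_integrand l (\<lambda>t. of_real t powr (- \<delta>) * ?B (of_real (1 / t))) x)"
    using int_sum unfolding set_integrable_def suminf_F .
  ultimately show ?thesis
    using sums_summable[OF sums_W] summable_norm_cancel[OF sum_T]
    unfolding W_def fox_wright_def by blast
qed

end
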